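(* Let $\Phi$ be a completely positive, trace-preserving, unital linear map on the $d\times d$ complex matrices, and let $\rho=(\Phi\otimes\mathrm{id})(|I\rangle\langle I|)$ be its normalised state representative, where $|I\rangle=\frac1{\sqrt d}\sum_{i=1}^d|i,i\rangle$. Then $\Phi$ is a random unitary map if and only if $E_A(\rho)$ has the maximal possible value $\log d$, i.e. $E_A(\rho)=\log d$.
   Context: A linear map $\Phi$ on $d\times d$ matrices is a random unitary map if $\Phi(X)=\sum_i p_iU_iXU_i^\dagger$ for all $X$, for some finite probability distribution $(p_i)$ and unitary $d\times d$ matrices $U_i$. Unital means $\Phi(\mathbb{1})=\mathbb{1}$. For a unit vector $\psi\in\mathbb{C}^d\otimes\mathbb{C}^d$, $E(\psi)=-\mathrm{Tr}[\sigma\log\sigma]$ with $\sigma=\mathrm{Tr}_B|\psi\rangle\langle\psi|$ (partial trace over the second factor) is the entropy of entanglement. The entanglement of assistance of a state (density matrix) $\rho$ on $\mathbb{C}^d\otimes\mathbb{C}^d$ is $$E_A(\rho)=\max_{\{p_i,\psi_i\}}\Big\{\sum_ip_iE(\psi_i):\ \sum_ip_i|\psi_i\rangle\langle\psi_i|=\rho\Big\},$$ the maximum being over finite ensembles of a probability distribution $(p_i)$ and unit vectors $\psi_i$. The same base of logarithm is used throughout. *)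

theory Defs
  imports "HOL-Analysis.Analysis"
begin

section \<open>Complex matrices\<close>

type_synonym 'n cmat = "complex^'n^'n"

definition mscale :: "complex \<Rightarrow> 'n cmat \<Rightarrow> 'n::finite cmat" where
  "mscale c A = (\<chi> i j. c * A $ i $ j)"

definition dagger :: "'n cmat \<Rightarrow> 'n::finite cmat" where
  "dagger A = (\<chi> i j. cnj (A $ j $ i))"

definition unitary :: "'n::finite cmat \<Rightarrow> bool" where
  "unitary U \<longleftrightarrow> dagger U ** U = mat 1 \<and> U ** dagger U = mat 1"

definition cinner :: "complex^'n \<Rightarrow> complex^'n::finite \<Rightarrow> complex" where
  "cinner v w = (\<Sum>i\<in>UNIV. cnj (v $ i) * w $ i)"

definition ketbra :: "complex^'n \<Rightarrow> 'n::finite cmat" where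
  "ketbra v = (\<chi> i j. v $ i * cnj (v $ j))"

definition diag_real :: "('n \<Rightarrow> real) \<Rightarrow> 'n::finite cmat" where
  "diag_real l = (\<chi> i j. if i = j then complex_of_real (l i) else 0)"

text \<open>Functional calculus of Hermitian matrices: apply a real function to the eigenvalues in an
  orthonormal eigenbasis. The result does not depend on the diagonalisation.\<close>

definition spectral_map :: "(real \<Rightarrow> real) \<Rightarrow> 'n cmat \<Rightarrow> 'n::finite cmat" where
  "spectral_map f A = (THE B. \<exists>U l. unitary U
      \<and> A = U ** diag_real l ** dagger U
      \<and> B = U ** diag_real (\<lambda>i. f (l i)) ** dagger U)"

text \<open>For a singular positive semidefinite matrix, the value \<open>log b 0 = 0\<close> implements the
  usual convention \<open>0 log 0 = 0\<close> in the entropy.\<close>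

definition matrix_log :: "real \<Rightarrow> 'n cmat \<Rightarrow> 'n::finite cmat" where
  "matrix_log b A = spectral_map (log b) A"

definition entropy :: "real \<Rightarrow> 'n::finite cmat \<Rightarrow> real" where
  "entropy b \<sigma> = - Re (trace (\<sigma> ** matrix_log b \<sigma>))"


section \<open>Maps on matrices\<close>

definition trace_preserving :: "('n cmat \<Rightarrow> 'n::finite cmat) \<Rightarrow> bool" where
  "trace_preserving \<Phi> \<longleftrightarrow> (\<forall>X. trace (\<Phi> X) = trace X)"

definition unital :: "('n cmat \<Rightarrow> 'n::finite cmat) \<Rightarrow> bool" where
  "unital \<Phi> \<longleftrightarrow> \<Phi> (mat 1) = mat 1"

text \<open>Complete positivity quantifies over ancillas of every dimension \<open>m\<close>. An operator on
  \<open>\<complex>\<^sup>d \<otimes> \<complex>\<^sup>m\<close> is represented as an \<open>m \<times> m\<close> array of \<open>d \<times> d\<close> blocks and a vector as an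
  \<open>m\<close>-tuple in \<open>\<complex>\<^sup>d\<close> (only indices below \<open>m\<close> matter); \<open>\<Phi> \<otimes> id\<close> acts by applying \<open>\<Phi>\<close> to each
  block. Over \<open>\<complex>\<close>, a nonnegative quadratic form already forces Hermiticity.\<close>

definition block_positive :: "nat \<Rightarrow> (nat \<Rightarrow> nat \<Rightarrow> 'n::finite cmat) \<Rightarrow> bool" where
  "block_positive m X \<longleftrightarrow>
    (\<forall>v :: nat \<Rightarrow> complex^'n.
       (\<Sum>a<m. \<Sum>b<m. cinner (v a) (X a b *v v b)) \<in> \<real> \<and>
       0 \<le> Re (\<Sum>a<m. \<Sum>b<m. cinner (v a) (X a b *v v b)))"

definition completely_positive :: "('n cmat \<Rightarrow> 'n::finite cmat) \<Rightarrow> bool" where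
  "completely_positive \<Phi> \<longleftrightarrow>
    (\<forall>m X. block_positive m X \<longrightarrow> block_positive m (\<lambda>a b. \<Phi> (X a b)))"

definition random_unitary :: "('n cmat \<Rightarrow> 'n::finite cmat) \<Rightarrow> bool" where
  "random_unitary \<Phi> \<longleftrightarrow>
    (\<exists>(m::nat) (p :: nat \<Rightarrow> real) (U :: nat \<Rightarrow> 'n cmat).
       (\<forall>i<m. 0 \<le> p i) \<and> (\<Sum>i<m. p i) = 1 \<and> (\<forall>i<m. unitary (U i)) \<and>
       (\<forall>X. \<Phi> X = (\<Sum>i<m. p i *\<^sub>R (U i ** X ** dagger (U i)))))"


section \<open>Bipartite systems\<close>

text \<open>\<open>\<complex>\<^sup>n \<otimes> \<complex>\<^sup>k\<close> is \<open>complex^('n \<times> 'k)\<close>, with \<open>|i,a\<rangle>\<close> the basis vector at index \<open>(i, a)\<close>.\<close>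

definition tensor_id ::
    "('n cmat \<Rightarrow> 'n cmat) \<Rightarrow> ('n \<times> 'k) cmat \<Rightarrow> ('n::finite \<times> 'k::finite) cmat" where
  "tensor_id \<Phi> X = (\<chi> r s. \<Phi> (\<chi> i j. X $ (i, snd r) $ (j, snd s)) $ fst r $ fst s)"

definition partial_trace_B :: "('n::finite \<times> 'k::finite) cmat \<Rightarrow> 'n cmat" where
  "partial_trace_B X = (\<chi> i j. \<Sum>a\<in>UNIV. X $ (i, a) $ (j, a))"

definition max_entangled :: "complex^('n::finite \<times> 'n)" where
  "max_entangled = (1 / sqrt (real CARD('n))) *\<^sub>R (\<Sum>i\<in>UNIV. axis (i, i) 1)"

definition state_rep :: "('n cmat \<Rightarrow> 'n cmat) \<Rightarrow> ('n::finite \<times> 'n) cmat" where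
  "state_rep \<Phi> = tensor_id \<Phi> (ketbra max_entangled)"

definition entanglement :: "real \<Rightarrow> complex^('n::finite \<times> 'n) \<Rightarrow> real" where
  "entanglement b \<psi> = entropy b (partial_trace_B (ketbra \<psi>))"

definition is_ensemble ::
    "('n::finite \<times> 'n) cmat \<Rightarrow> nat \<Rightarrow> (nat \<Rightarrow> real) \<Rightarrow> (nat \<Rightarrow> complex^('n \<times> 'n)) \<Rightarrow> bool" where
  "is_ensemble \<rho> m p \<psi> \<longleftrightarrow>
     (\<forall>i<m. 0 \<le> p i) \<and> (\<Sum>i<m. p i) = 1 \<and> (\<forall>i<m. norm (\<psi> i) = 1) \<and>
     (\<Sum>i<m. p i *\<^sub>R ketbra (\<psi> i)) = \<rho>"

definition entanglement_of_assistance :: "real \<Rightarrow> ('n::finite \<times> 'n) cmat \<Rightarrow> real" where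
  "entanglement_of_assistance b \<rho> =
     (GREATEST e. \<exists>m p \<psi>. is_ensemble \<rho> m p \<psi> \<and> e = (\<Sum>i<m. p i * entanglement b (\<psi> i)))"

end

theory Submission
  imports Defs
begin

text \<open>
  The reduced state of a unit vector has entropy at most \<open>log d\<close>, with equality only if it is
  \<open>1/d\<close> times the identity, that is, only if the vector is \<open>(U \<otimes> 1)|I\<rangle>\<close> for a unitary \<open>U\<close>.
  Under the Choi correspondence such a vector represents \<open>X \<mapsto> U X U\<^sup>\<dagger>\<close>, so ensembles of average
  entropy \<open>log d\<close> for the state representative are the same thing as random unitary
  decompositions of the map.

  The maximum defining the entanglement of assistance exists for every density matrix: the values
  reached by ensembles for \<open>\<rho>\<close> form the slice at \<open>\<rho>\<close> of the convex hull of the compact set of all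
  \<open>(|\<psi>\<rangle>\<langle>\<psi>|, E(\<psi>))\<close>. Without this, \<open>GREATEST\<close> would be unspecified and the value \<open>log d\<close> would
  not yield an ensemble.
\<close>


section \<open>Algebra of the complex inner product and of adjoints\<close>

lemma mat_eq_iff: "A = (B :: 'n::finite cmat) \<longleftrightarrow> (\<forall>i j. A $ i $ j = B $ i $ j)"
  by (simp add: vec_eq_iff)

lemma Re_cinner: "Re (cinner v w) = v \<bullet> w"
  by (simp add: cinner_def inner_vec_def inner_complex_def)

lemma cinner_self: "cinner v v = of_real ((norm v)\<^sup>2)"
proof -
  have "cinner v v = (\<Sum>i\<in>UNIV. of_real (v $ i \<bullet> v $ i))"
    unfolding cinner_def
    by (intro sum.cong) (auto simp: complex_eq_iff inner_complex_def)
  then show ?thesis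
    by (simp add: power2_norm_eq_inner inner_vec_def)
qed

lemma cinner_add_left: "cinner (u + v) w = cinner u w + cinner v w"
  by (simp add: cinner_def distrib_right sum.distrib)

lemma cinner_add_right: "cinner w (u + v) = cinner w u + cinner w v"
  by (simp add: cinner_def distrib_left sum.distrib)

lemma cinner_diff_right: "cinner w (u - v) = cinner w u - cinner w v"
  by (simp add: cinner_def right_diff_distrib sum_subtractf)

lemma cinner_scaleR_right: "cinner w (t *\<^sub>R u) = of_real t * cinner w u"
  by (simp add: cinner_def sum_distrib_left scaleR_conv_of_real[where 'a=complex] mult_ac)

lemma cinner_cnj: "cnj (cinner v w) = cinner w v"
  by (simp add: cinner_def mult.commute)

lemma cinner_matrix_vector: "cinner v (A *v w) = cinner (dagger A *v v) w"
  unfolding cinner_def matrix_vector_mult_def dagger_def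
  by (simp add: sum_distrib_left sum_distrib_right mult_ac) (rule sum.swap)

lemma matrix_vector_mult_scaleR_complex: "(A :: 'n::finite cmat) *v (t *\<^sub>R v) = t *\<^sub>R (A *v v)"
  by (simp add: vec_eq_iff matrix_vector_mult_def scaleR_sum_right)

lemma continuous_on_cinner [continuous_intros]:
  assumes "continuous_on S f" "continuous_on S g"
  shows "continuous_on S (\<lambda>x. cinner (f x) (g x))"
  unfolding cinner_def by (intro continuous_intros assms)

lemma continuous_on_matrix_vector: "continuous_on S (\<lambda>v. (A :: 'n::finite cmat) *v v)"
  unfolding matrix_vector_mult_def by (intro continuous_intros)

lemma dagger_dagger: "dagger (dagger A) = A"
  by (simp add: dagger_def vec_eq_iff)

section \<open>Spectral theorem and functional calculus\<close>

text \<open>The orthogonal complement \<open>V\<close> of the eigenvectors found so far is invariant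
  under \<open>A\<close>, because \<open>A\<close> is Hermitian with real eigenvalues on them. A
  maximiser of the quadratic form on the unit sphere of \<open>V\<close> is a further
  eigenvector.\<close>

lemma hermitian_imp_extend_eigenvectors:
  fixes A :: "'n::finite cmat"
  assumes herm: "dagger A = A" and k: "k < CARD('n)"
    and eig: "\<And>i. i < k \<Longrightarrow> A *v v i = l i *\<^sub>R v i"
  obtains w :: "complex^'n" and \<mu> :: real
  where "norm w = 1" "A *v w = \<mu> *\<^sub>R w" "\<And>i. i < k \<Longrightarrow> cinner (v i) w = 0"
proof -
  define V where "V = {w. \<forall>i<k. cinner (v i) w = 0}"
  have Vadd: "x + y \<in> V" if "x \<in> V" "y \<in> V" for x y
    using that by (simp add: V_def cinner_add_right)
  have Vdiff: "x - y \<in> V" if "x \<in> V" "y \<in> V" for x y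
    using that by (simp add: V_def cinner_diff_right)
  have Vscale: "t *\<^sub>R x \<in> V" if "x \<in> V" for x t
    using that by (simp add: V_def cinner_scaleR_right)
  have VA: "A *v x \<in> V" if "x \<in> V" for x
  proof -
    have "cinner (v i) (A *v x) = 0" if "i < k" for i
    proof -
      have "cinner (v i) (A *v x) = cinner (l i *\<^sub>R v i) x"
        by (simp add: cinner_matrix_vector herm eig that)
      also have "\<dots> = cnj (of_real (l i) * cinner x (v i))"
        by (metis cinner_cnj cinner_scaleR_right)
      also have "cinner x (v i) = 0"
        using \<open>x \<in> V\<close> that by (metis (mono_tags) V_def cinner_cnj complex_cnj_zero mem_Collect_eq)
      finally show ?thesis by simp
    qed
    then show ?thesis by (simp add: V_def)
  qed
  \<comment> \<open>Orthogonality in the library is that of the real inner product, the real part of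
    \<open>cinner\<close>. Including \<i> times each vector also kills the imaginary part; the at
    most \<open>2 * k\<close> vectors still leave room in real dimension
    \<open>2 * CARD('n)\<close>.\<close>
  define B where "B = v ` {..<k} \<union> (\<lambda>i. \<i> *s v i) ` {..<k}"
  have "finite B" by (simp add: B_def)
  have "card B \<le> k + k"
    unfolding B_def
    by (intro order.trans[OF card_Un_le] add_mono order.trans[OF card_image_le]) auto
  then have "dim B < DIM(complex^'n)"
    using dim_le_card'[OF \<open>finite B\<close>] k by simp
  then obtain x where x: "x \<noteq> 0" "\<And>y. y \<in> span B \<Longrightarrow> orthogonal x y"
    using orthogonal_to_subspace_exists[of B] by blast
  have "cinner (v i) x = 0" if "i < k" for i
  proof -
    have "v i \<in> span B" "\<i> *s v i \<in> span B"
      using that by (auto simp: B_def intro!: span_base)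
    then have "v i \<bullet> x = 0" "(\<i> *s v i) \<bullet> x = 0"
      using x(2) by (simp_all add: orthogonal_def inner_commute[of x])
    moreover have "Re (cinner (\<i> *s v i) x) = Im (cinner (v i) x)"
      by (simp add: cinner_def)
    ultimately show ?thesis
      by (simp add: complex_eq_iff Re_cinner)
  qed
  then have "x \<in> V" by (simp add: V_def)
  define S where "S = V \<inter> sphere 0 1"
  have "(1 / norm x) *\<^sub>R x \<in> S"
    using Vscale[OF \<open>x \<in> V\<close>] x(1) by (simp add: S_def)
  then have "S \<noteq> {}" by blast
  have "closed V"
    unfolding V_def
    by (intro closed_Collect_all closed_Collect_imp closed_Collect_eq continuous_intros) auto
  then have "compact S"
    unfolding S_def by (intro closed_Int_compact) auto
  define q where "q w = w \<bullet> (A *v w)" for w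
  have "continuous_on S q"
    unfolding q_def by (intro continuous_intros continuous_on_matrix_vector)
  then obtain w where w: "w \<in> S" and max: "\<And>y. y \<in> S \<Longrightarrow> q y \<le> q w"
    using continuous_attains_sup[OF \<open>compact S\<close> \<open>S \<noteq> {}\<close>] by metis
  have wV: "w \<in> V" and nw: "norm w = 1"
    using w by (auto simp: S_def)
  \<comment> \<open>Homogeneity of degree two extends the maximum from the unit sphere to all of
    \<open>V\<close>.\<close>
  have bound: "q y \<le> q w * (y \<bullet> y)" if "y \<in> V" for y
  proof (cases "y = 0")
    case True
    then show ?thesis by (simp add: q_def)
  next
    case False
    then have "(1 / norm y) *\<^sub>R y \<in> S"
      using Vscale[OF that] by (simp add: S_def)
    then have "q ((1 / norm y) *\<^sub>R y) \<le> q w" by (rule max)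
    moreover have "q ((1 / norm y) *\<^sub>R y) = q y / (y \<bullet> y)"
      by (simp add: q_def matrix_vector_mult_scaleR_complex dot_square_norm power2_eq_square)
    ultimately show ?thesis
      using False by (simp add: divide_le_eq)
  qed
  define z where "z = A *v w - q w *\<^sub>R w"
  have zV: "z \<in> V"
    unfolding z_def by (intro Vdiff VA Vscale wV)
  define N where "N = z \<bullet> z"
  define Q where "Q = q w * (z \<bullet> z) - q z"
  have "Q \<ge> 0" using bound[OF zV] by (simp add: Q_def)
  have symA: "x \<bullet> (A *v y) = y \<bullet> (A *v x)" for x y
  proof -
    have "x \<bullet> (A *v y) = Re (cinner (A *v x) y)"
      by (simp only: Re_cinner[symmetric] cinner_matrix_vector herm)
    then show ?thesis by (simp add: Re_cinner inner_commute)
  qed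
  have ww: "w \<bullet> w = 1" using nw by (simp add: dot_square_norm)
  have zN: "z \<bullet> (A *v w) - q w * (z \<bullet> w) = N"
    by (simp add: N_def z_def inner_diff_right inner_diff_left inner_commute algebra_simps)
  \<comment> \<open>First-order optimality of \<open>w\<close> in the direction of its own residual \<open>z\<close> forces \<open>z = 0\<close>.\<close>
  have expand: "0 \<le> t * (t * Q - 2 * N)" for t
  proof -
    have "w + t *\<^sub>R z \<in> V"
      by (intro Vadd wV Vscale zV)
    from bound[OF this] have "0 \<le> q w * ((w + t *\<^sub>R z) \<bullet> (w + t *\<^sub>R z)) - q (w + t *\<^sub>R z)"
      by simp
    also have "q (w + t *\<^sub>R z) = q w + 2 * t * (z \<bullet> (A *v w)) + t * t * q z"
      by (simp add: q_def matrix_vector_right_distrib matrix_vector_mult_scaleR_complex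
          inner_add_left inner_add_right symA[of w z] algebra_simps)
    also have "(w + t *\<^sub>R z) \<bullet> (w + t *\<^sub>R z) = 1 + 2 * t * (z \<bullet> w) + t * t * (z \<bullet> z)"
      by (simp add: inner_add_left inner_add_right ww inner_commute[of w z] algebra_simps)
    also have "q w * (1 + 2 * t * (z \<bullet> w) + t * t * (z \<bullet> z))
        - (q w + 2 * t * (z \<bullet> (A *v w)) + t * t * q z) = t * (t * Q - 2 * N)"
      by (simp add: Q_def zN[symmetric] algebra_simps)
    finally show ?thesis .
  qed
  have "N = 0"
  proof (rule ccontr)
    assume "N \<noteq> 0"
    then have "N > 0" by (simp add: N_def)
    \<comment> \<open>The \<open>+ 1\<close> keeps the denominator positive when
      \<open>Q = 0\<close>. This step size gives \<open>t * Q \<le> N\<close>, against the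
      \<open>2 * N \<le> t * Q\<close> that optimality demands.\<close>
    define t where "t = N / (Q + 1)"
    have "t > 0" using \<open>N > 0\<close> \<open>Q \<ge> 0\<close> by (simp add: t_def)
    then have "2 * N \<le> t * Q"
      using expand[of t] by (simp add: zero_le_mult_iff)
    also have "t * Q \<le> t * (Q + 1)" using \<open>t > 0\<close> by simp
    also have "\<dots> = N" using \<open>Q \<ge> 0\<close> by (simp add: t_def)
    finally show False using \<open>N > 0\<close> by simp
  qed
  then have "A *v w = q w *\<^sub>R w"
    by (simp add: N_def z_def)
  with nw wV that show ?thesis
    by (auto simp: V_def)
qed

lemma hermitian_imp_orthonormal_eigenvectors:
  fixes A :: "'n::finite cmat"
  assumes "dagger A = A" and "k \<le> CARD('n)"
  shows "\<exists>(v :: nat \<Rightarrow> complex^'n) l. \<forall>i<k. A *v v i = l i *\<^sub>R v i \<and>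
           (\<forall>j<k. cinner (v i) (v j) = (if i = j then 1 else 0))"
  using assms(2)
proof (induction k)
  case 0
  then show ?case by simp
next
  case (Suc k)
  then obtain v :: "nat \<Rightarrow> complex^'n" and l where
    eig: "\<And>i. i < k \<Longrightarrow> A *v v i = l i *\<^sub>R v i" and
    orth: "\<And>i j. i < k \<Longrightarrow> j < k \<Longrightarrow> cinner (v i) (v j) = (if i = j then 1 else 0)"
    by (metis Suc_leD)
  obtain w \<mu> where w: "norm w = 1" "A *v w = \<mu> *\<^sub>R w" "\<And>i. i < k \<Longrightarrow> cinner (v i) w = 0"
    using hermitian_imp_extend_eigenvectors[of A k v l] assms(1) eig Suc.prems by auto
  have w': "cinner w (v i) = 0" if "i < k" for i
    using w(3)[OF that] by (metis cinner_cnj complex_cnj_zero)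
  show ?case
    by (intro exI[of _ "v(k := w)"] exI[of _ "l(k := \<mu>)"])
      (auto simp: less_Suc_eq w w' eig orth cinner_self)
qed

lemma diagonalisation_nth:
  "(U ** diag_real l ** dagger U) $ i $ j = (\<Sum>k\<in>UNIV. U $ i $ k * of_real (l k) * cnj (U $ j $ k))"
  by (simp add: matrix_matrix_mult_def diag_real_def dagger_def mult_delta_left mult_delta_right)

text \<open>A full orthonormal family of eigenvectors, numbered by naturals, is carried to the index
  type by a bijection \<open>h\<close> and becomes the columns of \<open>U\<close>.\<close>

lemma hermitian_diagonalisable:
  fixes A :: "'n::finite cmat"
  assumes "dagger A = A"
  obtains U l where "unitary U" "A = U ** diag_real l ** dagger U"
proof -
  obtain v :: "nat \<Rightarrow> complex^'n" and l where
    eig: "\<And>i. i < CARD('n) \<Longrightarrow> A *v v i = l i *\<^sub>R v i" and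
    orth: "\<And>i j. i < CARD('n) \<Longrightarrow> j < CARD('n) \<Longrightarrow> cinner (v i) (v j) = (if i = j then 1 else 0)"
    using hermitian_imp_orthonormal_eigenvectors[OF assms order.refl] by metis
  obtain h :: "'n \<Rightarrow> nat" where h: "bij_betw h UNIV {..<CARD('n)}"
    using ex_bij_betw_finite_nat[of "UNIV :: 'n set"] by (auto simp: atLeast0LessThan)
  have hl: "h i < CARD('n)" for i using h by (auto simp: bij_betw_def)
  have hi: "h i = h j \<longleftrightarrow> i = j" for i j using h by (auto simp: bij_betw_def inj_on_def)
  define U :: "'n cmat" where "U = (\<chi> i j. v (h j) $ i)"
  have 1: "dagger U ** U = mat 1"
    using orth[OF hl hl]
    by (simp add: vec_eq_iff matrix_matrix_mult_def dagger_def U_def mat_def cinner_def hi)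
  then have 2: "U ** dagger U = mat 1" by (simp add: matrix_left_right_inverse)
  have "A ** U = U ** diag_real (\<lambda>i. l (h i))"
  proof (simp add: mat_eq_iff, intro allI)
    fix i j
    have "(A ** U) $ i $ j = (A *v v (h j)) $ i"
      by (simp add: matrix_matrix_mult_def matrix_vector_mult_def U_def)
    also have "\<dots> = (U ** diag_real (\<lambda>i. l (h i))) $ i $ j"
      by (simp add: eig hl matrix_matrix_mult_def diag_real_def U_def scaleR_conv_of_real[where 'a=complex]
          mult_delta_left mult_delta_right mult.commute)
    finally show "(A ** U) $ i $ j = (U ** diag_real (\<lambda>i. l (h i))) $ i $ j" .
  qed
  then have "A = U ** diag_real (\<lambda>i. l (h i)) ** dagger U"
    using 2 by (metis matrix_mul_assoc matrix_mul_rid)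
  then show ?thesis using 1 2 that by (metis unitary_def)
qed

text \<open>This settles the definite description in \<open>spectral_map\<close>: two
  diagonalisations of one matrix yield the same result after applying \<open>f\<close>, even with
  repeated eigenvalues.\<close>

lemma spectral_map_diagonalisation:
  fixes U :: "'n::finite cmat"
  assumes "unitary U"
  shows "spectral_map f (U ** diag_real l ** dagger U) = U ** diag_real (\<lambda>i. f (l i)) ** dagger U"
  unfolding spectral_map_def
proof (rule the_equality)
  show "\<exists>V m. unitary V \<and> U ** diag_real l ** dagger U = V ** diag_real m ** dagger V \<and>
      U ** diag_real (\<lambda>i. f (l i)) ** dagger U = V ** diag_real (\<lambda>i. f (m i)) ** dagger V"
    using assms by blast
next
  fix B
  assume "\<exists>V m. unitary V \<and> U ** diag_real l ** dagger U = V ** diag_real m ** dagger V \<and>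
      B = V ** diag_real (\<lambda>i. f (m i)) ** dagger V"
  then obtain V m where V: "unitary V"
    and eq: "U ** diag_real l ** dagger U = V ** diag_real m ** dagger V"
    and B: "B = V ** diag_real (\<lambda>i. f (m i)) ** dagger V" by blast
  \<comment> \<open>\<open>W\<close> intertwines the two diagonal matrices, so \<open>W $ i $ j\<close> vanishes unless \<open>l j = m i\<close>;
    hence it also intertwines their images under \<open>f\<close>.\<close>
  define W where "W = dagger V ** U"
  have W_diag: "(W ** diag_real g) $ i $ j = W $ i $ j * of_real (g j)"
    "(diag_real g ** W) $ i $ j = of_real (g i) * W $ i $ j" for g i j
    by (simp_all add: matrix_matrix_mult_def diag_real_def mult_delta_left mult_delta_right)
  have "W ** diag_real l = dagger V ** (U ** diag_real l ** dagger U) ** U"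
    using assms by (simp add: W_def unitary_def flip: matrix_mul_assoc)
  also have "\<dots> = (dagger V ** V) ** diag_real m ** W"
    by (simp add: eq W_def matrix_mul_assoc)
  finally have "W ** diag_real l = diag_real m ** W"
    using V by (simp add: unitary_def)
  then have "W $ i $ j * of_real (l j) = of_real (m i) * W $ i $ j" for i j
    by (metis W_diag)
  then have "W $ i $ j = 0 \<or> l j = m i" for i j
    by (metis mult.commute mult_cancel_left of_real_eq_iff)
  then have "W ** diag_real (\<lambda>i. f (l i)) = diag_real (\<lambda>i. f (m i)) ** W"
    unfolding mat_eq_iff W_diag by (metis mult.commute mult_zero_right)
  then have "V ** (W ** diag_real (\<lambda>i. f (l i))) ** dagger U
      = V ** (diag_real (\<lambda>i. f (m i)) ** W) ** dagger U" by simp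
  moreover have "V ** (W ** diag_real (\<lambda>i. f (l i))) ** dagger U
      = (V ** dagger V) ** U ** diag_real (\<lambda>i. f (l i)) ** dagger U"
    by (simp add: W_def matrix_mul_assoc)
  moreover have "V ** (diag_real (\<lambda>i. f (m i)) ** W) ** dagger U
      = V ** diag_real (\<lambda>i. f (m i)) ** dagger V ** (U ** dagger U)"
    by (simp add: W_def matrix_mul_assoc)
  ultimately show "B = U ** diag_real (\<lambda>i. f (l i)) ** dagger U"
    using V assms by (simp add: B unitary_def)
qed

lemma trace_diagonalisation:
  assumes "unitary U"
  shows "trace (U ** diag_real l ** dagger U) = of_real (\<Sum>i\<in>UNIV. l i)"
proof -
  have "trace (U ** diag_real l ** dagger U) = trace (dagger U ** U ** diag_real l)"
    by (metis trace_mul_sym matrix_mul_assoc)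
  then show ?thesis
    using assms by (simp add: unitary_def trace_def diag_real_def)
qed

lemma diag_real_mult: "diag_real f ** diag_real g = diag_real (\<lambda>i. f i * g i)"
  by (simp add: vec_eq_iff matrix_matrix_mult_def diag_real_def mult_delta_left mult_delta_right)

lemma entropy_diagonalisation:
  assumes "unitary U"
  shows "entropy b (U ** diag_real l ** dagger U) = - (\<Sum>i\<in>UNIV. l i * log b (l i))"
proof -
  have "(U ** diag_real l ** dagger U) ** (U ** diag_real (\<lambda>i. log b (l i)) ** dagger U)
      = U ** diag_real l ** (dagger U ** U) ** diag_real (\<lambda>i. log b (l i)) ** dagger U"
    by (simp add: matrix_mul_assoc)
  also have "\<dots> = U ** diag_real (\<lambda>i. l i * log b (l i)) ** dagger U"
    using assms by (simp add: unitary_def diag_real_mult flip: matrix_mul_assoc)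
  finally show ?thesis
    unfolding entropy_def matrix_log_def
    by (simp add: spectral_map_diagonalisation trace_diagonalisation assms)
qed

lemma cnj_delta: "cnj (if P then x else 0) = (if P then cnj x else 0)"
  by simp

lemma cinner_self_eq_1: "cinner v v = 1 \<Longrightarrow> norm v = 1"
  by (metis cinner_self norm_ge_zero norm_one of_real_eq_1_iff power2_eq_1_iff neg_0_le_iff_le not_one_le_zero)

lemma unitary_mat_1: "unitary (mat 1 :: 'n::finite cmat)"
proof -
  have "dagger (mat 1 :: 'n cmat) = mat 1"
    by (simp add: vec_eq_iff dagger_def mat_def)
  then show ?thesis by (simp add: unitary_def)
qed

lemma dagger_mult: "dagger (A ** B) = dagger B ** dagger A"
  by (simp add: vec_eq_iff dagger_def matrix_matrix_mult_def mult.commute)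

section \<open>Entropy of entanglement\<close>

text \<open>The quadratic form at the \<open>i\<close>-th column of \<open>U\<close>, a unit
  eigenvector, equals \<open>l i\<close>.\<close>

lemma eigenvalue_nonneg:
  fixes U :: "'n::finite cmat"
  assumes "unitary U" and A: "A = U ** diag_real l ** dagger U"
    and nonneg: "\<And>v. 0 \<le> Re (cinner v (A *v v))"
  shows "0 \<le> l i"
proof -
  define v where "v = U *v axis i 1"
  have "A *v v = U *v (diag_real l *v ((dagger U ** U) *v axis i 1))"
    by (simp add: A v_def matrix_vector_mul_assoc matrix_mul_assoc)
  also have "(dagger U ** U) *v axis i 1 = axis i 1"
    using assms(1) by (simp add: unitary_def)
  also have "diag_real l *v axis i 1 = l i *\<^sub>R axis i 1"
    by (simp add: vec_eq_iff matrix_vector_mult_def diag_real_def axis_def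
        mult_delta_left mult_delta_right scaleR_conv_of_real[where 'a=complex])
  finally have "A *v v = l i *\<^sub>R v"
    by (simp add: v_def matrix_vector_mult_scaleR_complex)
  moreover have "cinner v v = cinner (axis i 1) (axis i (1::complex) :: complex^'n)"
    using assms(1)
    by (metis v_def unitary_def cinner_matrix_vector matrix_vector_mul_assoc matrix_vector_mul_lid dagger_dagger)
  moreover have "cinner (axis i 1) (axis i (1::complex) :: complex^'n) = 1"
    by (simp add: cinner_def axis_def mult_delta_left mult_delta_right cnj_delta)
  ultimately show ?thesis
    using nonneg[of v] by (simp add: cinner_scaleR_right)
qed

text \<open>By polarisation, \<open>B x y + B y x\<close> is real for all \<open>x\<close> and
  \<open>y\<close>.\<close>

lemma real_quadratic_form_imp_hermitian:
  fixes A :: "'n::finite cmat"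
  assumes real: "\<And>v. cinner v (A *v v) \<in> \<real>"
  shows "dagger A = A"
proof -
  define B where "B x y = cinner x (A *v y)" for x y
  have B_axis: "B (axis i c) (axis j e) = cnj c * e * A $ i $ j" for i j c e
    by (simp add: B_def cinner_def matrix_vector_mult_def axis_def mult_delta_left mult_delta_right
        cnj_delta mult_ac)
  have B_add: "B (x + y) (x + y) = B x x + B x y + B y x + B y y" for x y
    by (simp add: B_def cinner_add_left cinner_add_right matrix_vector_right_distrib)
  have im: "Im (B x y) + Im (B y x) = 0" for x y
  proof -
    have "Im (B x x) = 0" "Im (B y y) = 0" "Im (B (x + y) (x + y)) = 0"
      using real by (simp_all add: B_def complex_is_Real_iff)
    then show ?thesis by (simp add: B_add)
  qed
  \<comment> \<open>The pair of basis vectors compares the imaginary parts of the two entries;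
    multiplying one of them by \<i> compares the real parts.\<close>
  have "cnj (A $ j $ i) = A $ i $ j" for i j
    using im[of "axis i 1" "axis j 1"] im[of "axis i 1" "axis j \<i>"]
    by (simp add: B_axis complex_eq_iff)
  then show ?thesis
    by (simp add: vec_eq_iff dagger_def)
qed

text \<open>Reshaping the vector into a matrix \<open>M\<close> turns its reduced state into
  \<open>M ** dagger M\<close>, which is visibly positive semidefinite.\<close>

definition coeff_matrix :: "complex^('n::finite \<times> 'n) \<Rightarrow> 'n cmat" where
  "coeff_matrix \<psi> = (\<chi> i a. \<psi> $ (i, a))"

lemma reduced_state_eq: "partial_trace_B (ketbra \<psi>) = coeff_matrix \<psi> ** dagger (coeff_matrix \<psi>)"
  by (simp add: vec_eq_iff partial_trace_B_def ketbra_def coeff_matrix_def matrix_matrix_mult_def dagger_def)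

lemma sum_UNIV_prod: "(\<Sum>r\<in>(UNIV :: ('a::finite \<times> 'b::finite) set). f r) = (\<Sum>i\<in>UNIV. \<Sum>a\<in>UNIV. f (i, a))"
  by (simp add: sum.cartesian_product)

lemma trace_reduced_state: "trace (partial_trace_B (ketbra \<psi>)) = of_real ((norm \<psi>)\<^sup>2)"
  unfolding cinner_self[symmetric] cinner_def sum_UNIV_prod
  by (simp add: trace_def partial_trace_B_def ketbra_def mult.commute)

lemma reduced_state_spectrum:
  fixes \<psi> :: "complex^('n::finite \<times> 'n)"
  assumes "norm \<psi> = 1" "unitary U" "partial_trace_B (ketbra \<psi>) = U ** diag_real l ** dagger U"
  shows "0 \<le> l i" "(\<Sum>i\<in>UNIV. l i) = 1"
proof -
  define M where "M = coeff_matrix \<psi>"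
  have "cinner v ((M ** dagger M) *v v) = cinner (dagger M *v v) (dagger M *v v)" for v
    by (simp add: cinner_matrix_vector[of v M] flip: matrix_vector_mul_assoc)
  then have "0 \<le> Re (cinner v (partial_trace_B (ketbra \<psi>) *v v))" for v
    by (simp add: reduced_state_eq M_def cinner_self)
  then show "0 \<le> l i"
    using eigenvalue_nonneg[OF assms(2,3)] by blast
  have "complex_of_real (\<Sum>i\<in>UNIV. l i) = 1"
    using trace_diagonalisation[OF assms(2), of l] trace_reduced_state[of \<psi>] assms(1)
    unfolding assms(3) by simp
  then show "(\<Sum>i\<in>UNIV. l i) = 1"
    by (metis of_real_eq_1_iff)
qed

lemma reduced_state_diagonalisable:
  fixes \<psi> :: "complex^('n::finite \<times> 'n)"
  obtains U l where "unitary U" "partial_trace_B (ketbra \<psi>) = U ** diag_real l ** dagger U"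
proof -
  have "dagger (partial_trace_B (ketbra \<psi>)) = partial_trace_B (ketbra \<psi>)"
    by (simp add: reduced_state_eq dagger_mult dagger_dagger)
  then show ?thesis using hermitian_diagonalisable that by blast
qed

text \<open>The summands of the relative entropy (in nats) of a distribution to the uniform one on \<open>n\<close>
  points, shifted by \<open>1 / n - x\<close> so that each is nonnegative; the shifts sum to zero.\<close>

lemma relative_entropy_term:
  assumes "0 \<le> (x::real)" "0 < n"
  shows "0 \<le> 1 / n - x + x * (ln x + ln n)"
    and "1 / n - x + x * (ln x + ln n) = 0 \<Longrightarrow> x = 1 / n"
proof -
  \<comment> \<open>For \<open>x > 0\<close> the term becomes \<open>x * (y - 1 - ln y)\<close>, so
    \<open>ln y \<le> y - 1\<close>, with equality only at \<open>y = 1\<close>, gives both claims.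
    At \<open>x = 0\<close> the term is \<open>1 / n\<close>, which is positive.\<close>
  define y where "y = 1 / (n * x)"
  have eq: "1 / n - x + x * (ln x + ln n) = x * (y - 1 - ln y)" and "y > 0" if "x > 0"
    using that assms by (simp_all add: y_def ln_div ln_mult field_simps)
  have le: "0 \<le> y - 1 - ln y" if "x > 0"
    using ln_le_minus_one[OF \<open>x > 0 \<Longrightarrow> y > 0\<close>[OF that]] by simp
  show "0 \<le> 1 / n - x + x * (ln x + ln n)"
  proof (cases "x = 0")
    case False
    then show ?thesis using assms eq le by simp
  qed (use assms in simp)
  assume 0: "1 / n - x + x * (ln x + ln n) = 0"
  show "x = 1 / n"
  proof (cases "x = 0")
    case False
    then have "x > 0" using assms by simp
    then have "ln y = y - 1" using 0 eq by simp
    then have "y = 1" using ln_eq_minus_one \<open>x > 0 \<Longrightarrow> y > 0\<close>[OF \<open>x > 0\<close>] by blast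
    then show ?thesis using \<open>x > 0\<close> assms by (simp add: y_def field_simps)
  qed (use 0 assms in simp)
qed

text \<open>The gap between the two sides, times \<open>ln b\<close>, is the sum of the nonnegative
  terms \<open>f i\<close>. A zero gap therefore makes every term vanish, which forces the uniform
  distribution.\<close>

lemma shannon_entropy_le_log_card:
  fixes l :: "'n::finite \<Rightarrow> real"
  assumes b: "1 < b" and nonneg: "\<And>i. 0 \<le> l i" and sum: "(\<Sum>i\<in>UNIV. l i) = 1"
  shows "- (\<Sum>i\<in>UNIV. l i * log b (l i)) \<le> log b CARD('n)"
    and "- (\<Sum>i\<in>UNIV. l i * log b (l i)) = log b CARD('n) \<Longrightarrow> l i = 1 / CARD('n)"
proof -
  define n where "n = real CARD('n)"
  have n: "n > 0" by (simp add: n_def)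
  define f where "f i = 1 / n - l i + l i * (ln (l i) + ln n)" for i
  have "(\<Sum>i\<in>UNIV. f i) = (\<Sum>i\<in>UNIV. l i * ln (l i)) + ln n"
    using n by (simp add: f_def sum.distrib sum_subtractf sum distrib_left flip: sum_distrib_right)
      (simp add: n_def)
  also have "\<dots> = (log b n + (\<Sum>i\<in>UNIV. l i * log b (l i))) * ln b"
    using b by (simp add: log_def distrib_right sum_distrib_right)
  finally have f: "(\<Sum>i\<in>UNIV. f i) = (log b n + (\<Sum>i\<in>UNIV. l i * log b (l i))) * ln b" .
  have f0: "f i \<ge> 0" for i
    unfolding f_def using relative_entropy_term(1)[OF nonneg n] .
  then have "0 \<le> (\<Sum>i\<in>UNIV. f i)" by (simp add: sum_nonneg)
  then show "- (\<Sum>i\<in>UNIV. l i * log b (l i)) \<le> log b CARD('n)"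
    using b by (simp add: f n_def zero_le_mult_iff)
  assume "- (\<Sum>i\<in>UNIV. l i * log b (l i)) = log b CARD('n)"
  then have "(\<Sum>i\<in>UNIV. f i) = 0" by (simp add: f n_def)
  then have "f i = 0" using f0 by (simp add: sum_nonneg_eq_0_iff)
  then show "l i = 1 / CARD('n)"
    unfolding f_def using relative_entropy_term(2)[OF nonneg n] by (simp add: n_def)
qed

lemma entanglement_le:
  fixes \<psi> :: "complex^('n::finite \<times> 'n)"
  assumes "1 < b" "norm \<psi> = 1"
  shows "entanglement b \<psi> \<le> log b CARD('n)"
proof -
  obtain U l where U: "unitary U" "partial_trace_B (ketbra \<psi>) = U ** diag_real l ** dagger U"
    by (rule reduced_state_diagonalisable)
  show ?thesis
    using shannon_entropy_le_log_card(1)[OF assms(1) reduced_state_spectrum[OF assms(2) U]]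
    by (simp add: entanglement_def U entropy_diagonalisation)
qed

lemma entanglement_max_imp_reduced_state:
  fixes \<psi> :: "complex^('n::finite \<times> 'n)"
  assumes "1 < b" "norm \<psi> = 1" "entanglement b \<psi> = log b CARD('n)"
  shows "partial_trace_B (ketbra \<psi>) = diag_real (\<lambda>_. 1 / CARD('n))"
proof -
  obtain U l where U: "unitary U" "partial_trace_B (ketbra \<psi>) = U ** diag_real l ** dagger U"
    by (rule reduced_state_diagonalisable)
  have "- (\<Sum>i\<in>UNIV. l i * log b (l i)) = log b CARD('n)"
    using assms(3) by (simp add: entanglement_def U entropy_diagonalisation)
  then have "l = (\<lambda>_. 1 / CARD('n))"
    using shannon_entropy_le_log_card(2)[OF assms(1) reduced_state_spectrum[OF assms(2) U]] by blast
  \<comment> \<open>With all eigenvalues equal the diagonal matrix is scalar, so conjugation by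
    \<open>U\<close> leaves it unchanged.\<close>
  moreover have "U ** diag_real (\<lambda>_. c) = diag_real (\<lambda>_. c) ** U" for c
    by (simp add: vec_eq_iff matrix_matrix_mult_def diag_real_def mult_delta_left mult_delta_right mult.commute)
  ultimately show ?thesis
    using U by (simp add: unitary_def flip: matrix_mul_assoc)
qed

lemma continuous_on_x_log_x: "continuous_on {0..} (\<lambda>x::real. x * log b x)"
proof -
  have "isCont (\<lambda>x. x * ln x) x" if "x > 0" for x :: real
    using that by (intro continuous_intros) auto
  then have pos: "((\<lambda>x. x * ln x) \<longlongrightarrow> x * ln x) (at x within {0..})" if "x > 0" for x :: real
    using that by (metis isCont_def subset_UNIV tendsto_within_subset)
  \<comment> \<open>The only delicate point is zero. Substituting the inverse of \<open>x\<close>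
    reduces the limit to that of \<open>ln x / x\<close> at infinity.\<close>
  have zero: "((\<lambda>x::real. x * ln x) \<longlongrightarrow> 0) (at 0 within {0..})"
    unfolding at_within_Ici_at_right filterlim_at_right_to_top
  proof (rule Lim_transform_eventually)
    show "((\<lambda>x::real. - (ln x / x)) \<longlongrightarrow> 0) at_top"
      using tendsto_minus[OF ln_x_over_x_tendsto_0] by simp
    show "\<forall>\<^sub>F x::real in at_top. - (ln x / x) = inverse x * ln (inverse x)"
      using eventually_gt_at_top[of 0]
      by (rule eventually_mono) (simp add: ln_inverse divide_inverse)
  qed
  have "continuous_on {0..} (\<lambda>x::real. x * ln x)"
    unfolding continuous_on_def
  proof
    fix x :: real assume "x \<in> {0..}"
    then show "((\<lambda>x. x * ln x) \<longlongrightarrow> x * ln x) (at x within {0..})"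
      using pos[of x] zero by (cases "x = 0") auto
  qed
  then have "continuous_on {0..} (\<lambda>x::real. x * ln x * (1 / ln b))"
    by (rule continuous_on_mult_right)
  then show ?thesis by (simp add: log_def)
qed

text \<open>The rows are unit vectors. The fixed norm makes the set of unitaries bounded for the
  compactness argument.\<close>

lemma norm_unitary:
  fixes U :: "'n::finite cmat"
  assumes "unitary U"
  shows "norm U = sqrt CARD('n)"
proof -
  have "norm (U $ i) = 1" for i
  proof -
    have "cinner (U $ i) (U $ i) = (U ** dagger U) $ i $ i"
      by (simp add: cinner_def matrix_matrix_mult_def dagger_def mult.commute)
    then show ?thesis
      using assms by (intro cinner_self_eq_1) (simp add: unitary_def mat_def)
  qed
  then show ?thesis by (simp add: norm_vec_def L2_set_def)
qed

section \<open>Attainment of the entanglement of assistance\<close>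

text \<open>Pairing each pure state with its entanglement lets one convex hull record both the
  averaged state and the averaged entanglement of an ensemble.\<close>

definition pure_state_graph :: "real \<Rightarrow> (('n::finite \<times> 'n) cmat \<times> real) set" where
  "pure_state_graph b = (\<lambda>\<psi>. (ketbra \<psi>, entanglement b \<psi>)) ` sphere 0 1"

text \<open>Carrying the diagonalisation of the reduced state along as extra data exhibits the graph as a
  continuous image of a compact set, so continuity of the spectral decomposition is never needed.\<close>

lemma compact_pure_state_graph:
  "compact (pure_state_graph b :: (('n::finite \<times> 'n) cmat \<times> real) set)"
proof -
  \<comment> \<open>Triples of a unit vector, a diagonalising unitary and the eigenvalues. The
    bounds on the eigenvalues make \<open>T\<close> bounded and keep them where
    \<open>x * log b x\<close> is continuous.\<close>
  define T :: "((complex^('n \<times> 'n)) \<times> 'n cmat \<times> (real^'n)) set" where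
    "T = {t. norm (fst t) = 1 \<and> unitary (fst (snd t)) \<and> (\<forall>i. 0 \<le> snd (snd t) $ i) \<and> (\<forall>i. snd (snd t) $ i \<le> 1) \<and>
       partial_trace_B (ketbra (fst t)) =
         fst (snd t) ** diag_real (\<lambda>i. snd (snd t) $ i) ** dagger (fst (snd t))}"
  define F where "F t = (ketbra (fst t), - (\<Sum>i\<in>UNIV. snd (snd t) $ i * log b (snd (snd t) $ i)))"
    for t :: "(complex^('n \<times> 'n)) \<times> 'n cmat \<times> (real^'n)"
  have "T \<subseteq> sphere 0 1 \<times> sphere 0 (sqrt CARD('n)) \<times> cbox 0 (\<chi> i. 1)"
    by (auto simp: T_def norm_unitary mem_box_cart)
  moreover have "bounded (sphere (0 :: complex^('n \<times> 'n)) 1 \<times> sphere (0 :: 'n cmat) (sqrt CARD('n)) \<times> cbox 0 (\<chi> i. (1::real)))"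
    by (intro bounded_Times) auto
  ultimately have "bounded T" using bounded_subset by blast
  \<comment> \<open>Entry by entry, all conditions are equations or weak inequalities between
    continuous functions.\<close>
  moreover have "closed T"
    unfolding T_def unitary_def mat_eq_iff diagonalisation_nth
    unfolding matrix_matrix_mult_def dagger_def partial_trace_B_def ketbra_def
    by (simp only: vec_lambda_beta)
      (intro closed_Collect_conj closed_Collect_all closed_Collect_eq closed_Collect_le continuous_intros)
  ultimately have "compact T" by (simp add: compact_eq_bounded_closed)
  moreover have "continuous_on T F"
  proof -
    have xlogx: "continuous_on T (\<lambda>t. snd (snd t) $ i * log b (snd (snd t) $ i))" for i
      by (rule continuous_on_compose2[OF continuous_on_x_log_x]) (auto simp: T_def intro!: continuous_intros)
    show ?thesis
      unfolding F_def ketbra_def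
      by (intro continuous_on_Pair continuous_on_minus continuous_on_sum xlogx) (intro continuous_intros)
  qed
  ultimately have "compact (F ` T)" by (rule compact_continuous_image[rotated])
  also have "F ` T = pure_state_graph b"
  proof (intro equalityI subsetI)
    fix y assume "y \<in> F ` T"
    then show "y \<in> pure_state_graph b"
      by (auto simp: F_def T_def pure_state_graph_def entanglement_def entropy_diagonalisation)
  next
    fix y :: "('n \<times> 'n) cmat \<times> real" assume "y \<in> pure_state_graph b"
    then obtain \<psi> where \<psi>: "norm \<psi> = 1" and y: "y = (ketbra \<psi>, entanglement b \<psi>)"
      by (auto simp: pure_state_graph_def)
    obtain U l where U: "unitary U" "partial_trace_B (ketbra \<psi>) = U ** diag_real l ** dagger U"
      by (rule reduced_state_diagonalisable)
    note l = reduced_state_spectrum[OF \<psi> U]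
    have "l i \<le> 1" for i
      using member_le_sum[of i UNIV l] l by simp
    moreover have "($) (\<chi> i. l i) = l" by (simp add: fun_eq_iff)
    ultimately have "(\<psi>, U, \<chi> i. l i) \<in> T"
      using \<psi> U l(1) by (simp add: T_def)
    moreover have "F (\<psi>, U, \<chi> i. l i) = y"
      by (simp add: F_def y entanglement_def U entropy_diagonalisation)
    ultimately show "y \<in> F ` T" by blast
  qed
  finally show ?thesis .
qed

lemma ensemble_iff_convex_hull:
  "(\<exists>m p \<psi>. is_ensemble \<rho> m p \<psi> \<and> e = (\<Sum>i<m. p i * entanglement b (\<psi> i)))
     \<longleftrightarrow> (\<rho>, e) \<in> convex hull pure_state_graph b"
proof
  assume "\<exists>m p \<psi>. is_ensemble \<rho> m p \<psi> \<and> e = (\<Sum>i<m. p i * entanglement b (\<psi> i))"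
  then obtain m p \<psi> where ens: "is_ensemble \<rho> m p \<psi>" and e: "e = (\<Sum>i<m. p i * entanglement b (\<psi> i))"
    by blast
  have "(\<Sum>i<m. p i *\<^sub>R (ketbra (\<psi> i), entanglement b (\<psi> i))) \<in> convex hull pure_state_graph b"
    using ens
    by (intro convex_sum) (auto simp: is_ensemble_def pure_state_graph_def intro!: hull_inc)
  also have "(\<Sum>i<m. p i *\<^sub>R (ketbra (\<psi> i), entanglement b (\<psi> i))) = (\<rho>, e)"
    using ens by (simp add: prod_eq_iff fst_sum snd_sum is_ensemble_def e)
  finally show "(\<rho>, e) \<in> convex hull pure_state_graph b" .
next
  assume "(\<rho>, e) \<in> convex hull pure_state_graph b"
  then obtain k p x where
    x: "\<forall>i\<in>{1::nat..k}. 0 \<le> p i \<and> x i \<in> pure_state_graph b" and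
    p: "sum p {1..k} = 1" and s: "(\<Sum>i = 1..k. p i *\<^sub>R x i) = (\<rho>, e)"
    unfolding convex_hull_indexed by blast
  then have "\<forall>i\<in>{1..k}. \<exists>\<psi>. norm \<psi> = 1 \<and> x i = (ketbra \<psi>, entanglement b \<psi>)"
    by (force simp: pure_state_graph_def)
  then obtain \<psi> where \<psi>: "\<forall>i\<in>{1..k}. norm (\<psi> i) = 1 \<and> x i = (ketbra (\<psi> i), entanglement b (\<psi> i))"
    by metis
  have "(\<Sum>i = 1..k. p i *\<^sub>R x i) = (\<Sum>i = 1..k. p i *\<^sub>R (ketbra (\<psi> i), entanglement b (\<psi> i)))"
    using \<psi> by (intro sum.cong) auto
  then have "(\<Sum>i = 1..k. p i *\<^sub>R ketbra (\<psi> i)) = \<rho>" "(\<Sum>i = 1..k. p i * entanglement b (\<psi> i)) = e"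
    using s by (simp_all add: prod_eq_iff fst_sum snd_sum)
  \<comment> \<open>Hull combinations are indexed from 1 to \<open>k\<close>, ensembles from 0 to
    \<open>k - 1\<close>; hence the shift by \<open>Suc\<close>.\<close>
  then have "is_ensemble \<rho> k (\<lambda>i. p (Suc i)) (\<lambda>i. \<psi> (Suc i)) \<and>
      e = (\<Sum>i<k. p (Suc i) * entanglement b (\<psi> (Suc i)))"
    using x p \<psi> by (simp add: is_ensemble_def sum.atLeast1_atMost_eq)
  then show "\<exists>m p \<psi>. is_ensemble \<rho> m p \<psi> \<and> e = (\<Sum>i<m. p i * entanglement b (\<psi> i))"
    by blast
qed

text \<open>The spectral decomposition of a density matrix is an ensemble of its eigenvectors, so
  the slice of the hull at \<rho> is nonempty.\<close>

lemma density_matrix_in_convex_hull: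
  fixes \<rho> :: "('n::finite \<times> 'n) cmat"
  assumes psd: "\<And>v. cinner v (\<rho> *v v) \<in> \<real>" "\<And>v. 0 \<le> Re (cinner v (\<rho> *v v))"
    and tr: "trace \<rho> = 1"
  shows "\<exists>e. (\<rho>, e) \<in> convex hull pure_state_graph b"
proof -
  obtain U l where U: "unitary U" and \<rho>: "\<rho> = U ** diag_real l ** dagger U"
    using hermitian_diagonalisable[OF real_quadratic_form_imp_hermitian[OF psd(1)]] by blast
  have l: "0 \<le> l r" for r
    by (rule eigenvalue_nonneg[OF U \<rho> psd(2)])
  have "complex_of_real (\<Sum>r\<in>UNIV. l r) = 1"
    using trace_diagonalisation[OF U, of l] tr by (simp add: \<rho>)
  then have l1: "(\<Sum>r\<in>UNIV. l r) = 1" by (metis of_real_eq_1_iff)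
  define u where "u r = column r U" for r
  have "cinner (u r) (u r) = (dagger U ** U) $ r $ r" for r
    by (simp add: cinner_def matrix_matrix_mult_def dagger_def u_def column_def)
  then have nu: "norm (u r) = 1" for r
    using U by (intro cinner_self_eq_1) (simp add: unitary_def mat_def)
  have "(\<Sum>r\<in>UNIV. l r *\<^sub>R (ketbra (u r), entanglement b (u r))) \<in> convex hull pure_state_graph b"
    using l l1 nu by (intro convex_sum) (auto simp: pure_state_graph_def intro!: hull_inc)
  moreover have "(\<Sum>r\<in>UNIV. l r *\<^sub>R (ketbra (u r), entanglement b (u r))) =
      (\<rho>, \<Sum>r\<in>UNIV. l r * entanglement b (u r))"
    by (simp add: prod_eq_iff fst_sum snd_sum mat_eq_iff \<rho> diagonalisation_nth ketbra_def u_def column_def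
        scaleR_conv_of_real[where 'a=complex] mult_ac)
  ultimately show ?thesis by metis
qed

text \<open>The hull of a compact set in finite dimension is compact, and so is its closed slice at
  \<rho>. The second coordinate then attains a maximum there, which is the value of
  \<open>GREATEST\<close>.\<close>

lemma entanglement_of_assistance_attained:
  fixes \<rho> :: "('n::finite \<times> 'n) cmat"
  assumes "\<And>v. cinner v (\<rho> *v v) \<in> \<real>" "\<And>v. 0 \<le> Re (cinner v (\<rho> *v v))" "trace \<rho> = 1"
  obtains m p \<psi> where "is_ensemble \<rho> m p \<psi>"
    "entanglement_of_assistance b \<rho> = (\<Sum>i<m. p i * entanglement b (\<psi> i))"
proof -
  define S where "S = snd ` (convex hull pure_state_graph b \<inter> {x. fst x = \<rho>})"
  have S: "e \<in> S \<longleftrightarrow> (\<rho>, e) \<in> convex hull pure_state_graph b" for e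
    by (force simp: S_def)
  have "closed {x :: ('n \<times> 'n) cmat \<times> real. fst x = \<rho>}"
    by (intro closed_Collect_eq continuous_intros)
  then have "compact S"
    unfolding S_def
    by (intro compact_continuous_image continuous_intros compact_Int_closed
        compact_convex_hull compact_pure_state_graph)
  moreover have "S \<noteq> {}"
    using density_matrix_in_convex_hull[OF assms] S by blast
  ultimately obtain e where e: "e \<in> S" "\<And>y. y \<in> S \<Longrightarrow> y \<le> e"
    using compact_attains_sup by metis
  have "entanglement_of_assistance b \<rho> = e"
    unfolding entanglement_of_assistance_def ensemble_iff_convex_hull
    by (rule Greatest_equality) (use e S in auto)
  with e(1) that show ?thesis
    unfolding S ensemble_iff_convex_hull[symmetric] by blast
qed

section \<open>The Choi correspondence\<close>

definition matrix_unit :: "'n \<Rightarrow> 'n \<Rightarrow> 'n::finite cmat" where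
  "matrix_unit a c = (\<chi> i j. if i = a \<and> j = c then 1 else 0)"

lemma max_entangled_nth:
  "(max_entangled :: complex^('n::finite \<times> 'n)) $ (i, a) = (if i = a then 1 / sqrt CARD('n) else 0)"
proof -
  have "(\<Sum>k\<in>UNIV. axis (k, k) (1::complex) $ (i, a)) = (\<Sum>k\<in>UNIV. if k = i then if i = a then 1 else 0 else 0)"
    by (intro sum.cong) (auto simp: axis_def)
  then show ?thesis
    by (simp add: max_entangled_def scaleR_conv_of_real[where 'a=complex])
qed

lemma sqrt_card_mult: "complex_of_real (sqrt CARD('n::finite)) * complex_of_real (sqrt CARD('n)) = of_nat CARD('n)"
  by (metis of_real_mult of_real_of_nat_eq real_sqrt_mult_self abs_of_nat)

text \<open>Up to the factor \<open>1 / CARD('n)\<close> the state representative is the Choi matrix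
  of the map: its blocks are the images of the matrix units.\<close>

lemma state_rep_nth:
  fixes \<Phi> :: "'n cmat \<Rightarrow> 'n::finite cmat"
  assumes "Vector_Spaces.linear mscale mscale \<Phi>"
  shows "state_rep \<Phi> $ (i, a) $ (j, c) = \<Phi> (matrix_unit a c) $ i $ j / CARD('n)"
proof -
  interpret module_hom mscale mscale \<Phi>
    using assms by (simp add: module_hom_iff_linear)
  have "(\<chi> p q. ketbra max_entangled $ (p, a) $ (q, c)) = mscale (1 / CARD('n)) (matrix_unit a c)"
    using sqrt_card_mult[where 'n='n]
    by (simp add: vec_eq_iff mscale_def matrix_unit_def ketbra_def max_entangled_nth)
  then show ?thesis
    by (simp add: state_rep_def tensor_id_def scale) (simp add: mscale_def)
qed

text \<open>Inversion of the Choi correspondence, obtained by expanding \<open>X\<close> in matrix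
  units.\<close>

lemma linear_map_eq_state_rep:
  fixes \<Phi> :: "'n cmat \<Rightarrow> 'n::finite cmat"
  assumes "Vector_Spaces.linear mscale mscale \<Phi>"
  shows "\<Phi> X $ i $ j = CARD('n) * (\<Sum>a\<in>UNIV. \<Sum>c\<in>UNIV. X $ a $ c * state_rep \<Phi> $ (i, a) $ (j, c))"
proof -
  interpret module_hom mscale mscale \<Phi>
    using assms by (simp add: module_hom_iff_linear)
  have "(if i = a \<and> j = c then x else 0) = (if c = j then if a = i then x else 0 else 0)" for i j a c :: 'n and x :: complex
    by auto
  then have "X = (\<Sum>a\<in>UNIV. \<Sum>c\<in>UNIV. mscale (X $ a $ c) (matrix_unit a c))"
    by (simp add: vec_eq_iff mscale_def matrix_unit_def mult_delta_right)
  then have "\<Phi> X = \<Phi> (\<Sum>a\<in>UNIV. \<Sum>c\<in>UNIV. mscale (X $ a $ c) (matrix_unit a c))" by simp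
  also have "\<dots> = (\<Sum>a\<in>UNIV. \<Sum>c\<in>UNIV. mscale (X $ a $ c) (\<Phi> (matrix_unit a c)))"
    by (simp add: sum scale)
  finally show ?thesis
    by (simp add: state_rep_nth[OF assms] sum_distrib_left) (simp add: mscale_def)
qed

lemma trace_state_rep:
  fixes \<Phi> :: "'n cmat \<Rightarrow> 'n::finite cmat"
  assumes "Vector_Spaces.linear mscale mscale \<Phi>" "trace_preserving \<Phi>"
  shows "trace (state_rep \<Phi>) = 1"
proof -
  have "trace (state_rep \<Phi>) = (\<Sum>a\<in>UNIV. trace (\<Phi> (matrix_unit a a)) / CARD('n))"
    by (simp add: trace_def sum_UNIV_prod state_rep_nth[OF assms(1)] sum_divide_distrib) (rule sum.swap)
  also have "\<dots> = 1"
    using assms(2) by (simp add: trace_preserving_def) (simp add: trace_def matrix_unit_def)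
  finally show ?thesis .
qed

text \<open>Complete positivity is applied to the block array of all matrix units, the unnormalised
  projector onto the maximally entangled vector.\<close>

lemma state_rep_psd:
  fixes \<Phi> :: "'n cmat \<Rightarrow> 'n::finite cmat"
  assumes lin: "Vector_Spaces.linear mscale mscale \<Phi>" and cp: "completely_positive \<Phi>"
  shows "cinner w (state_rep \<Phi> *v w) \<in> \<real> \<and> 0 \<le> Re (cinner w (state_rep \<Phi> *v w))"
proof -
  define d where "d = CARD('n)"
  \<comment> \<open>Ancilla indices in \<open>block_positive\<close> are naturals below
    \<open>d\<close>, so the index type is numbered by \<open>h\<close>.\<close>
  obtain h :: "nat \<Rightarrow> 'n" where h: "bij_betw h {..<d} UNIV"
    using ex_bij_betw_nat_finite[of "UNIV :: 'n set"] by (auto simp: atLeast0LessThan d_def)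
  have entry: "cinner x (matrix_unit a c *v y) = cnj (x $ a) * y $ c" for x y :: "complex^'n" and a c
  proof -
    have "matrix_unit a c *v y = axis a (y $ c)"
      by (auto simp: vec_eq_iff matrix_unit_def matrix_vector_mult_def axis_def mult_delta_left)
    then show ?thesis by (simp add: cinner_def axis_def mult_delta_right)
  qed
  have "block_positive d (\<lambda>a c. matrix_unit (h a) (h c))"
    unfolding block_positive_def
  proof
    fix v :: "nat \<Rightarrow> complex^'n"
    \<comment> \<open>The quadratic form of the matrix unit array factorises as the squared modulus
      of \<open>s\<close>.\<close>
    define s where "s = (\<Sum>a<d. v a $ h a)"
    have "(\<Sum>a<d. \<Sum>c<d. cinner (v a) (matrix_unit (h a) (h c) *v v c)) = cnj s * s"
      by (simp add: entry s_def sum_product)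
    also have "\<dots> = of_real ((norm s)\<^sup>2)"
      by (metis complex_norm_square mult.commute)
    finally show "(\<Sum>a<d. \<Sum>c<d. cinner (v a) (matrix_unit (h a) (h c) *v v c)) \<in> \<real> \<and>
        0 \<le> Re (\<Sum>a<d. \<Sum>c<d. cinner (v a) (matrix_unit (h a) (h c) *v v c))"
      by simp
  qed
  then have pos: "block_positive d (\<lambda>a c. \<Phi> (matrix_unit (h a) (h c)))"
    using cp unfolding completely_positive_def by blast
  define v where "v a = (\<chi> i. w $ (i, a))" for a
  define q where "q = (\<Sum>a<d. \<Sum>c<d. cinner (v (h a)) (\<Phi> (matrix_unit (h a) (h c)) *v v (h c)))"
  have q: "q \<in> \<real>" "0 \<le> Re q"
    using pos unfolding block_positive_def q_def by (auto dest: spec[of _ "\<lambda>a. v (h a)"])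
  have "q = (\<Sum>a\<in>UNIV. \<Sum>c\<in>UNIV. cinner (v a) (\<Phi> (matrix_unit a c) *v v c))"
    unfolding q_def
    by (simp add: sum.reindex_bij_betw[OF h, of "\<lambda>c. cinner _ (\<Phi> (matrix_unit _ c) *v v c)"]
        sum.reindex_bij_betw[OF h, of "\<lambda>a. \<Sum>c\<in>UNIV. cinner (v a) (\<Phi> (matrix_unit a c) *v v c)"])
  also have "\<dots> = (\<Sum>a\<in>UNIV. \<Sum>c\<in>UNIV. \<Sum>i\<in>UNIV. \<Sum>j\<in>UNIV. cnj (w $ (i, a)) * (\<Phi> (matrix_unit a c) $ i $ j * w $ (j, c)))"
    by (simp add: cinner_def matrix_vector_mult_def v_def sum_distrib_left)
  \<comment> \<open>The sums are reordered to match the splitting of sums over the pairs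
    \<open>(i, a)\<close> and \<open>(j, c)\<close>.\<close>
  also have "\<dots> = (\<Sum>a\<in>UNIV. \<Sum>i\<in>UNIV. \<Sum>c\<in>UNIV. \<Sum>j\<in>UNIV. cnj (w $ (i, a)) * (\<Phi> (matrix_unit a c) $ i $ j * w $ (j, c)))"
    by (intro sum.cong sum.swap refl)
  also have "\<dots> = (\<Sum>i\<in>UNIV. \<Sum>a\<in>UNIV. \<Sum>j\<in>UNIV. \<Sum>c\<in>UNIV. cnj (w $ (i, a)) * (\<Phi> (matrix_unit a c) $ i $ j * w $ (j, c)))"
    by (subst sum.swap) (intro sum.cong sum.swap refl)
  also have "\<dots> = d * cinner w (state_rep \<Phi> *v w)"
    by (simp add: cinner_def matrix_vector_mult_def sum_UNIV_prod state_rep_nth[OF lin]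
        sum_distrib_left d_def)
  finally have "cinner w (state_rep \<Phi> *v w) = q / d"
    by (simp add: d_def)
  also have "\<dots> = of_real (Re q / d)"
    using q(1) by simp
  finally have "cinner w (state_rep \<Phi> *v w) = of_real (Re q / d)" .
  moreover have "0 \<le> Re q / d" using q(2) by simp
  ultimately show ?thesis by (metis Reals_of_real Re_complex_of_real)
qed

text \<open>The vector \<open>(U \<otimes> 1)|I\<rangle>\<close>.\<close>

definition unitary_vector :: "'n cmat \<Rightarrow> complex^('n::finite \<times> 'n)" where
  "unitary_vector U = (\<chi> r. U $ fst r $ snd r / sqrt CARD('n))"

lemma sandwich_nth:
  "(U ** X ** dagger U) $ i $ j = (\<Sum>a\<in>UNIV. \<Sum>c\<in>UNIV. X $ a $ c * (U $ i $ a * cnj (U $ j $ c)))"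
  by (subst sum.swap)
    (simp add: matrix_matrix_mult_def dagger_def sum_distrib_left sum_distrib_right mult_ac)

lemma ketbra_unitary_vector_nth:
  fixes U :: "'n::finite cmat"
  shows "ketbra (unitary_vector U) $ (i, a) $ (j, c) = U $ i $ a * cnj (U $ j $ c) / CARD('n)"
  using sqrt_card_mult[where 'n='n]
  by (simp add: ketbra_def unitary_vector_def)

lemma reduced_state_unitary_vector:
  fixes U :: "'n::finite cmat"
  shows "partial_trace_B (ketbra (unitary_vector U)) $ i $ j = (U ** dagger U) $ i $ j / CARD('n)"
  by (simp add: partial_trace_B_def ketbra_unitary_vector_nth matrix_matrix_mult_def dagger_def sum_divide_distrib)

lemma unitary_vector_max_entangled:
  fixes U :: "'n::finite cmat"
  assumes "unitary U"
  shows "norm (unitary_vector U) = 1" "entanglement b (unitary_vector U) = log b CARD('n)"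
proof -
  have UU: "U ** dagger U = mat 1"
    using assms by (simp add: unitary_def)
  have "mat 1 ** D ** dagger (mat 1) = D" for D :: "'n cmat"
    using unitary_mat_1 by (metis unitary_def matrix_mul_lid matrix_mul_rid)
  moreover have "partial_trace_B (ketbra (unitary_vector U)) = diag_real (\<lambda>_. 1 / CARD('n))"
    unfolding mat_eq_iff reduced_state_unitary_vector UU by (simp add: diag_real_def mat_def)
  ultimately have red: "partial_trace_B (ketbra (unitary_vector U)) =
      mat 1 ** diag_real (\<lambda>_. 1 / CARD('n)) ** dagger (mat 1)"
    by simp
  have "cinner (unitary_vector U) (unitary_vector U) = 1"
    by (simp only: cinner_self trace_reduced_state[symmetric] red trace_diagonalisation[OF unitary_mat_1]) simp
  then show "norm (unitary_vector U) = 1"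
    by (rule cinner_self_eq_1)
  show "entanglement b (unitary_vector U) = log b CARD('n)"
    unfolding entanglement_def red entropy_diagonalisation[OF unitary_mat_1]
    by (simp add: log_divide)
qed

lemma max_entangled_imp_unitary_vector:
  fixes \<psi> :: "complex^('n::finite \<times> 'n)"
  assumes "1 < b" "norm \<psi> = 1" "entanglement b \<psi> = log b CARD('n)"
  obtains U where "unitary U" "\<psi> = unitary_vector U"
proof -
  \<comment> \<open>The factor \<open>sqrt CARD('n)\<close> undoes the normalisation in
    \<open>unitary_vector\<close>; a reduced state equal to \<open>1 / CARD('n)\<close> times the
    identity then says exactly \<open>U ** dagger U = mat 1\<close>.\<close>
  define U :: "'n cmat" where "U = (\<chi> i a. sqrt CARD('n) * \<psi> $ (i, a))"
  have \<psi>: "\<psi> = unitary_vector U"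
    by (simp add: vec_eq_iff unitary_vector_def U_def)
  have "(U ** dagger U) $ i $ j / CARD('n) = diag_real (\<lambda>_. 1 / CARD('n)) $ i $ j" for i j
    using entanglement_max_imp_reduced_state[OF assms] reduced_state_unitary_vector[of U i j]
    by (simp add: \<psi>)
  then have "U ** dagger U = mat 1"
    by (auto simp: mat_eq_iff diag_real_def mat_def field_simps split: if_splits)
  then have "unitary U"
    by (simp add: unitary_def matrix_left_right_inverse)
  with \<psi> that show ?thesis by blast
qed

section \<open>The two directions of the equivalence\<close>

text \<open>The unitaries give an ensemble of maximally entangled vectors, which reaches the upper
  bound that \<open>entanglement_le\<close> imposes on every ensemble.\<close>

lemma random_unitary_imp_entanglement_of_assistance:
  fixes \<Phi> :: "'n cmat \<Rightarrow> 'n::finite cmat"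
  assumes b: "1 < b" and lin: "Vector_Spaces.linear mscale mscale \<Phi>" and "random_unitary \<Phi>"
  shows "entanglement_of_assistance b (state_rep \<Phi>) = log b CARD('n)"
proof -
  obtain m p U where p: "\<forall>i<m. 0 \<le> p i" "(\<Sum>i<m. p i) = 1" and U: "\<forall>i<m. unitary (U i)"
    and \<Phi>: "\<And>X. \<Phi> X = (\<Sum>i<(m::nat). p i *\<^sub>R (U i ** X ** dagger (U i)))"
    using assms(3) unfolding random_unitary_def by blast
  have unit: "(V ** matrix_unit a c ** dagger V) $ i $ j = V $ i $ a * cnj (V $ j $ c)" for V :: "'n cmat" and i j a c
  proof -
    have "(V ** matrix_unit a c) $ i $ k = (if k = c then V $ i $ a else 0)" for k
      by (simp add: matrix_matrix_mult_def matrix_unit_def mult_delta_right)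
    then show ?thesis
      by (simp add: matrix_matrix_mult_def[of "_ ** _"] dagger_def mult_delta_left)
  qed
  have "state_rep \<Phi> $ (i, a) $ (j, c) = (\<Sum>k<m. p k *\<^sub>R ketbra (unitary_vector (U k))) $ (i, a) $ (j, c)" for i a j c
    by (simp add: state_rep_nth[OF lin] \<Phi> unit ketbra_unitary_vector_nth sum_divide_distrib
        scaleR_conv_of_real[where 'a=complex])
  then have "state_rep \<Phi> = (\<Sum>k<m. p k *\<^sub>R ketbra (unitary_vector (U k)))"
    unfolding mat_eq_iff split_paired_All by blast
  then have ens: "is_ensemble (state_rep \<Phi>) m p (\<lambda>k. unitary_vector (U k))"
    using p unitary_vector_max_entangled(1)[OF U[rule_format]] by (simp add: is_ensemble_def)
  show ?thesis
    unfolding entanglement_of_assistance_def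
  proof (rule Greatest_equality)
    have "(\<Sum>k<m. p k * entanglement b (unitary_vector (U k))) = (\<Sum>k<m. p k * log b CARD('n))"
      using U by (intro sum.cong) (auto simp: unitary_vector_max_entangled)
    then have "log b CARD('n) = (\<Sum>k<m. p k * entanglement b (unitary_vector (U k)))"
      using p(2) by (simp flip: sum_distrib_right)
    with ens show "\<exists>m p \<psi>. is_ensemble (state_rep \<Phi>) m p \<psi> \<and>
        log b CARD('n) = (\<Sum>i<m. p i * entanglement b (\<psi> i))" by blast
  next
    fix e assume "\<exists>m p \<psi>. is_ensemble (state_rep \<Phi>) m p \<psi> \<and> e = (\<Sum>i<m. p i * entanglement b (\<psi> i))"
    then obtain m p \<psi> where ens: "is_ensemble (state_rep \<Phi>) m p \<psi>"
      and e: "e = (\<Sum>i<m. p i * entanglement b (\<psi> i))" by blast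
    have "e \<le> (\<Sum>i<m. p i * log b CARD('n))"
      unfolding e using ens b
      by (intro sum_mono mult_left_mono entanglement_le) (auto simp: is_ensemble_def)
    also have "\<dots> = log b CARD('n)"
      using ens by (simp add: is_ensemble_def flip: sum_distrib_right)
    finally show "e \<le> log b CARD('n)" .
  qed
qed

lemma entanglement_of_assistance_imp_random_unitary:
  fixes \<Phi> :: "'n cmat \<Rightarrow> 'n::finite cmat"
  assumes b: "1 < b" and lin: "Vector_Spaces.linear mscale mscale \<Phi>"
    and cp: "completely_positive \<Phi>" and tp: "trace_preserving \<Phi>"
    and EA: "entanglement_of_assistance b (state_rep \<Phi>) = log b CARD('n)"
  shows "random_unitary \<Phi>"
proof -
  obtain m p \<psi> where ens: "is_ensemble (state_rep \<Phi>) m p \<psi>"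
    and e: "entanglement_of_assistance b (state_rep \<Phi>) = (\<Sum>k<m. p k * entanglement b (\<psi> k))"
    using entanglement_of_assistance_attained[of "state_rep \<Phi>" b]
      state_rep_psd[OF lin cp] trace_state_rep[OF lin tp] by metis
  have p: "\<And>k. k < m \<Longrightarrow> 0 \<le> p k" "(\<Sum>k<m. p k) = 1" and \<psi>: "\<And>k. k < m \<Longrightarrow> norm (\<psi> k) = 1"
    and \<rho>: "state_rep \<Phi> = (\<Sum>k<m. p k *\<^sub>R ketbra (\<psi> k))"
    using ens by (auto simp: is_ensemble_def)
  \<comment> \<open>An average equal to the upper bound of its terms has zero total deficit, so
    every term of nonzero weight is maximal.\<close>
  have "(\<Sum>k<m. p k * (log b CARD('n) - entanglement b (\<psi> k))) = 0"
    using e EA p(2) by (simp add: right_diff_distrib sum_subtractf flip: sum_distrib_right)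
  moreover have "\<forall>k\<in>{..<m}. 0 \<le> p k * (log b CARD('n) - entanglement b (\<psi> k))"
    using p(1) \<psi> by (simp add: entanglement_le[OF b])
  ultimately have "\<forall>k\<in>{..<m}. p k * (log b CARD('n) - entanglement b (\<psi> k)) = 0"
    by (subst (asm) sum_nonneg_eq_0_iff) auto
  then have max: "entanglement b (\<psi> k) = log b CARD('n)" if "k < m" "p k \<noteq> 0" for k
    using that by auto
  \<comment> \<open>Nothing is known about a vector of weight zero, so the claim is stated for
    weighted projectors and the identity serves as its unitary.\<close>
  have "\<exists>U. unitary U \<and> p k *\<^sub>R ketbra (\<psi> k) = p k *\<^sub>R ketbra (unitary_vector U)" if "k < m" for k
  proof (cases "p k = 0")
    case True
    then show ?thesis using unitary_mat_1 by auto
  next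
    case False
    then show ?thesis
      using max_entangled_imp_unitary_vector[OF b \<psi>[OF that] max[OF that]] by metis
  qed
  then obtain U where U: "\<And>k. k < m \<Longrightarrow> unitary (U k)"
    and pU: "\<And>k. k < m \<Longrightarrow> p k *\<^sub>R ketbra (\<psi> k) = p k *\<^sub>R ketbra (unitary_vector (U k))"
    by metis
  have \<rho>U: "state_rep \<Phi> = (\<Sum>k<m. p k *\<^sub>R ketbra (unitary_vector (U k)))"
    unfolding \<rho> by (intro sum.cong pU) auto
  have "\<Phi> X = (\<Sum>k<m. p k *\<^sub>R (U k ** X ** dagger (U k)))" for X
    unfolding mat_eq_iff
  proof (intro allI)
    fix i j
    have "\<Phi> X $ i $ j = (\<Sum>a\<in>UNIV. \<Sum>c\<in>UNIV. \<Sum>k<m. p k *\<^sub>R (X $ a $ c * (U k $ i $ a * cnj (U k $ j $ c))))"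
      by (simp add: linear_map_eq_state_rep[OF lin] \<rho>U ketbra_unitary_vector_nth sum_distrib_left)
    also have "\<dots> = (\<Sum>k<m. \<Sum>a\<in>UNIV. \<Sum>c\<in>UNIV. p k *\<^sub>R (X $ a $ c * (U k $ i $ a * cnj (U k $ j $ c))))"
      by (simp only: sum.swap[where A = UNIV and B = "{..<m}"])
    also have "\<dots> = (\<Sum>k<m. p k *\<^sub>R (U k ** X ** dagger (U k))) $ i $ j"
      by (simp add: sandwich_nth scaleR_sum_right)
    finally show "\<Phi> X $ i $ j = (\<Sum>k<m. p k *\<^sub>R (U k ** X ** dagger (U k))) $ i $ j" .
  qed
  then show ?thesis
    unfolding random_unitary_def using p U by blast
qed

theorem mainTheorem10:
  fixes \<Phi> :: "complex^'n^'n \<Rightarrow> complex^'n::finite^'n" and b :: real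
  assumes "1 < b"
    and "Vector_Spaces.linear mscale mscale \<Phi>"
    and "completely_positive \<Phi>"
    and "trace_preserving \<Phi>"
    and "unital \<Phi>"
  shows "random_unitary \<Phi> \<longleftrightarrow>
    entanglement_of_assistance b (state_rep \<Phi>) = log b (real CARD('n))"
  using random_unitary_imp_entanglement_of_assistance entanglement_of_assistance_imp_random_unitary
    assms by blast

end
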